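(* Let $\mathcal{B}$ be an unconditional basis in a quasi-Banach space $\mathbb{B}$ such that for some $\beta\ge0$ and $\gamma>0$ we have either (i) $h_r(N)\gtrsim N^\beta(\log N)^\gamma$ and $h_\ell(N)\lesssim N^\beta$, or (ii) $h_r(N)\gtrsim N^\beta$ and $h_\ell(N)\lesssim N^\beta(\log N)^{-\gamma}$ (for $N\ge2$). Then $\mathscr{G}^\alpha_\tau(\mathcal{B},\mathbb{B})\neq\mathcal{A}^\alpha_\tau(\mathcal{B},\mathbb{B})$ for all $\alpha>0$ and all $\tau\in(0,\infty]$.
   Context: Basis. $(\mathbb{B},\|\cdot\|_{\mathbb{B}})$ is a quasi-Banach space whose quasi-norm satisfies $\|x+y\|_{\mathbb{B}}^{\rho}\le\|x\|_{\mathbb{B}}^{\rho}+\|y\|_{\mathbb{B}}^{\rho}$ for some fixed $\rho\in(0,1]$. A sequence $\mathcal{B}=\{e_j\}_{j=1}^\infty$ is a basis if each $x\in\mathbb{B}$ is uniquely $x=\sum_j c_je_j$ with convergence in $\|\cdot\|_{\mathbb{B}}$; it is unconditional (with constant $K$) if $\|\sum_j\lambda_jc_je_j\|_{\mathbb{B}}\le K\|\sum_jc_je_j\|_{\mathbb{B}}$ whenever $|\lambda_j|\le1$. Standing assumptions: $\|e_j\|_{\mathbb{B}}=1$ for all $j$ and $K=1$. Democracy functions. $h_r(N)=\sup_{|\Gamma|=N}\|\sum_{k\in\Gamma}e_k\|_{\mathbb{B}}$ and $h_\ell(N)=\inf_{|\Gamma|=N}\|\sum_{k\in\Gamma}e_k\|_{\mathbb{B}}$,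 over $\Gamma\subset\mathbb{N}$, $N=1,2,\dots$. Approximation spaces and greedy classes. $\Sigma_N$ is the set of $y\in\mathbb{B}$ with at most $N$ nonzero coefficients; $\sigma_N(x)=\inf_{y\in\Sigma_N}\|x-y\|_{\mathbb{B}}$. For $x=\sum_jc_je_j$, and any bijection $\pi$ of $\mathbb{N}$ with $|c_{\pi(j)}|\ge|c_{\pi(j+1)}|$ for all $j$, let $G_N^\pi(x)=\sum_{j=1}^Nc_{\pi(j)}e_{\pi(j)}$, and $\gamma_N(x)=\sup_\pi\|x-G_N^\pi(x)\|_{\mathbb{B}}$ over all such $\pi$. For $\alpha>0$, $0<\tau\le\infty$, $\mathcal{A}^\alpha_\tau(\mathcal{B},\mathbb{B})$ is the set of $x\in\mathbb{B}$ with $\|x\|_{\mathcal{A}^\alpha_\tau}=\|x\|_{\mathbb{B}}+\big[\sum_{N\ge1}(N^\alpha\sigma_N(x))^\tau\frac1N\big]^{1/\tau}<\infty$ (with $\sup_{N\ge1}N^\alpha\sigma_N(x)$ instead of the bracket if $\tau=\infty$); $\mathscr{G}^\alpha_\tau(\mathcal{B},\mathbb{B})$ and $\|\cdot\|_{\mathscr{G}^\alpha_\tau}$ are defined in the same way with $\gamma_N$ in place of $\sigma_N$. $X\hookrightarrow Y$ means $X\subset Y$ and there is $C>0$ with $\|x\|_Y\le C\|x\|_X$ for all $x\in X$. Equality of spaces $X=Y$ is interpreted as $X\hookrightarrow Y$ and $Y\hookrightarrow X$, and $X\ne Y$ is its negation. $a(N)\lesssim b(N)$ means $a(N)\le Cb(N)$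 with $C$ independent of $N$; $\gtrsim$ is the reverse.
   Formalization: Greedy orderings π are injections of ℕ whose range contains the support of x, not bijections of ℕ: no decreasing bijection exists when x has infinite support and some zero coefficient, leaving γ_N(x) undefined. Whenever such a bijection exists the greedy sums are the same. *)

theory Defs
  imports Complex_Main "HOL-Library.Extended_Real"
begin

text \<open>The scalar type class \<^class>\<open>real_normed_field\<close> covers the two scalar fields \<open>\<real>\<close> and \<open>\<complex>\<close>
  (and, up to isomorphism, only these).\<close>

locale quasi_banach_space = vector_space scale
  for scale :: "'k::real_normed_field \<Rightarrow> 'b::ab_group_add \<Rightarrow> 'b" +
  fixes qnorm :: "'b \<Rightarrow> real" and \<rho> :: real
  assumes rho_pos: "0 < \<rho>" and rho_le_1: "\<rho> \<le> 1"
    and qnorm_nonneg: "0 \<le> qnorm x"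
    and qnorm_eq_0_iff: "qnorm x = 0 \<longleftrightarrow> x = 0"
    and qnorm_scale: "qnorm (scale a x) = norm a * qnorm x"
    and qnorm_add: "qnorm (x + y) powr \<rho> \<le> qnorm x powr \<rho> + qnorm y powr \<rho>"
    and complete: "(\<forall>\<epsilon>>0. \<exists>M. \<forall>m\<ge>M. \<forall>n\<ge>M. qnorm (X m - X n) < \<epsilon>)
        \<Longrightarrow> \<exists>x. (\<lambda>n. qnorm (X n - x)) \<longlonglongrightarrow> 0"

definition series_converges_to ::
    "('k::real_normed_field \<Rightarrow> 'b::ab_group_add \<Rightarrow> 'b) \<Rightarrow> ('b \<Rightarrow> real) \<Rightarrow>
     (nat \<Rightarrow> 'b) \<Rightarrow> (nat \<Rightarrow> 'k) \<Rightarrow> 'b \<Rightarrow> bool" where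
  "series_converges_to scale qnorm e c x \<longleftrightarrow>
     (\<lambda>n. qnorm (x - (\<Sum>j<n. scale (c j) (e j)))) \<longlonglongrightarrow> 0"

text \<open>Basis vectors are indexed from \<open>0\<close>.\<close>

definition is_basis ::
    "('k::real_normed_field \<Rightarrow> 'b::ab_group_add \<Rightarrow> 'b) \<Rightarrow> ('b \<Rightarrow> real) \<Rightarrow> (nat \<Rightarrow> 'b) \<Rightarrow> bool" where
  "is_basis scale qnorm e \<longleftrightarrow> (\<forall>x. \<exists>!c. series_converges_to scale qnorm e c x)"

definition basis_coeff ::
    "('k::real_normed_field \<Rightarrow> 'b::ab_group_add \<Rightarrow> 'b) \<Rightarrow> ('b \<Rightarrow> real) \<Rightarrow>
     (nat \<Rightarrow> 'b) \<Rightarrow> 'b \<Rightarrow> nat \<Rightarrow> 'k" where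
  "basis_coeff scale qnorm e x = (THE c. series_converges_to scale qnorm e c x)"

definition unconditional_basis ::
    "('k::real_normed_field \<Rightarrow> 'b::ab_group_add \<Rightarrow> 'b) \<Rightarrow> ('b \<Rightarrow> real) \<Rightarrow>
     (nat \<Rightarrow> 'b) \<Rightarrow> real \<Rightarrow> bool" where
  "unconditional_basis scale qnorm e K \<longleftrightarrow>
     is_basis scale qnorm e \<and>
     (\<forall>c x l. series_converges_to scale qnorm e c x \<and> (\<forall>j. norm (l j) \<le> 1) \<longrightarrow>
        (\<exists>y. series_converges_to scale qnorm e (\<lambda>j. l j * c j) y \<and> qnorm y \<le> K * qnorm x))"

text \<open>For a \<open>\<rho>\<close>-norm and normalised \<open>e\<close>, the norms below lie in \<open>[0, N powr (1/\<rho>)]\<close>,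
  so the real supremum is a genuine one.\<close>

definition h_r :: "('b::ab_group_add \<Rightarrow> real) \<Rightarrow> (nat \<Rightarrow> 'b) \<Rightarrow> nat \<Rightarrow> real" where
  "h_r qnorm e N = (SUP \<Gamma>\<in>{\<Gamma>. finite \<Gamma> \<and> card \<Gamma> = N}. qnorm (\<Sum>k\<in>\<Gamma>. e k))"

definition h_l :: "('b::ab_group_add \<Rightarrow> real) \<Rightarrow> (nat \<Rightarrow> 'b) \<Rightarrow> nat \<Rightarrow> real" where
  "h_l qnorm e N = (INF \<Gamma>\<in>{\<Gamma>. finite \<Gamma> \<and> card \<Gamma> = N}. qnorm (\<Sum>k\<in>\<Gamma>. e k))"

definition lesssim_from_2 :: "(nat \<Rightarrow> real) \<Rightarrow> (nat \<Rightarrow> real) \<Rightarrow> bool" where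
  "lesssim_from_2 a b \<longleftrightarrow> (\<exists>C>0. \<forall>N\<ge>2. a N \<le> C * b N)"

definition sparse_vectors ::
    "('k::real_normed_field \<Rightarrow> 'b::ab_group_add \<Rightarrow> 'b) \<Rightarrow> ('b \<Rightarrow> real) \<Rightarrow>
     (nat \<Rightarrow> 'b) \<Rightarrow> nat \<Rightarrow> 'b set" where
  "sparse_vectors scale qnorm e N =
     {y. finite {j. basis_coeff scale qnorm e y j \<noteq> 0} \<and>
         card {j. basis_coeff scale qnorm e y j \<noteq> 0} \<le> N}"

definition sigma_err ::
    "('k::real_normed_field \<Rightarrow> 'b::ab_group_add \<Rightarrow> 'b) \<Rightarrow> ('b \<Rightarrow> real) \<Rightarrow>
     (nat \<Rightarrow> 'b) \<Rightarrow> 'b \<Rightarrow> nat \<Rightarrow> real" where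
  "sigma_err scale qnorm e x N = (INF y\<in>sparse_vectors scale qnorm e N. qnorm (x - y))"

text \<open>A decreasing rearrangement of \<open>c\<close> by a bijection of the whole of \<open>\<nat>\<close> does not exist when
  \<open>c\<close> has infinitely many nonzero entries and also a zero entry. Hence \<open>\<pi>\<close> is only required to
  be a bijection onto some index set containing the support of \<open>c\<close>. Whenever a decreasing
  bijection of \<open>\<nat>\<close> exists, this yields the same greedy sums: if \<open>c\<close> has no zeros then \<open>\<pi>\<close> is
  onto, and if \<open>c\<close> has finite support then \<open>\<pi>\<close> first lists the support and the other terms
  of the sums vanish.\<close>

definition greedy_ordering :: "(nat \<Rightarrow> 'k::real_normed_field) \<Rightarrow> (nat \<Rightarrow> nat) \<Rightarrow> bool" where
  "greedy_ordering c \<pi> \<longleftrightarrow>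
     inj \<pi> \<and> {j. c j \<noteq> 0} \<subseteq> range \<pi> \<and> (\<forall>j. norm (c (\<pi> j)) \<ge> norm (c (\<pi> (Suc j))))"

definition greedy_sum ::
    "('k::real_normed_field \<Rightarrow> 'b::ab_group_add \<Rightarrow> 'b) \<Rightarrow> ('b \<Rightarrow> real) \<Rightarrow>
     (nat \<Rightarrow> 'b) \<Rightarrow> (nat \<Rightarrow> nat) \<Rightarrow> nat \<Rightarrow> 'b \<Rightarrow> 'b" where
  "greedy_sum scale qnorm e \<pi> N x =
     (\<Sum>j<N. scale (basis_coeff scale qnorm e x (\<pi> j)) (e (\<pi> j)))"

text \<open>For a \<open>1\<close>-unconditional normalised basis the coefficients tend to \<open>0\<close>, so greedy orderings
  exist, and the errors are bounded by \<open>qnorm x\<close>; the real supremum is again a genuine one.\<close>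

definition gamma_err ::
    "('k::real_normed_field \<Rightarrow> 'b::ab_group_add \<Rightarrow> 'b) \<Rightarrow> ('b \<Rightarrow> real) \<Rightarrow>
     (nat \<Rightarrow> 'b) \<Rightarrow> 'b \<Rightarrow> nat \<Rightarrow> real" where
  "gamma_err scale qnorm e x N =
     (SUP \<pi>\<in>{\<pi>. greedy_ordering (basis_coeff scale qnorm e x) \<pi>}.
        qnorm (x - greedy_sum scale qnorm e \<pi> N x))"

text \<open>Discrete weighted Lorentz-type functional of a nonnegative sequence \<open>(s N)\<close> with \<open>N \<ge> 1\<close>:
  finiteness and value. The series is reindexed by \<open>N = Suc n\<close>.\<close>

definition weight_finite :: "real \<Rightarrow> ereal \<Rightarrow> (nat \<Rightarrow> real) \<Rightarrow> bool" where
  "weight_finite \<alpha> \<tau> s \<longleftrightarrow>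
     (if \<tau> = \<infinity> then bdd_above ((\<lambda>N. real N powr \<alpha> * s N) ` {1..})
      else summable (\<lambda>n. (real (Suc n) powr \<alpha> * s (Suc n)) powr real_of_ereal \<tau> * (1 / real (Suc n))))"

definition weight_value :: "real \<Rightarrow> ereal \<Rightarrow> (nat \<Rightarrow> real) \<Rightarrow> real" where
  "weight_value \<alpha> \<tau> s =
     (if \<tau> = \<infinity> then (SUP N\<in>{1..}. real N powr \<alpha> * s N)
      else (\<Sum>n. (real (Suc n) powr \<alpha> * s (Suc n)) powr real_of_ereal \<tau> * (1 / real (Suc n)))
             powr (1 / real_of_ereal \<tau>))"

text \<open>A (quasi-normed) space is represented by its underlying set together with its quasi-norm,
  which is meaningful on that set only.\<close>

type_synonym 'b qspace = "'b set \<times> ('b \<Rightarrow> real)"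

definition error_space :: "('b \<Rightarrow> real) \<Rightarrow> ('b \<Rightarrow> nat \<Rightarrow> real) \<Rightarrow> real \<Rightarrow> ereal \<Rightarrow> 'b qspace" where
  "error_space qnorm err \<alpha> \<tau> =
     ({x. weight_finite \<alpha> \<tau> (err x)}, \<lambda>x. qnorm x + weight_value \<alpha> \<tau> (err x))"

definition approx_space ::
    "('k::real_normed_field \<Rightarrow> 'b::ab_group_add \<Rightarrow> 'b) \<Rightarrow> ('b \<Rightarrow> real) \<Rightarrow>
     (nat \<Rightarrow> 'b) \<Rightarrow> real \<Rightarrow> ereal \<Rightarrow> 'b qspace" where
  "approx_space scale qnorm e = error_space qnorm (sigma_err scale qnorm e)"

definition greedy_class ::
    "('k::real_normed_field \<Rightarrow> 'b::ab_group_add \<Rightarrow> 'b) \<Rightarrow> ('b \<Rightarrow> real) \<Rightarrow>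
     (nat \<Rightarrow> 'b) \<Rightarrow> real \<Rightarrow> ereal \<Rightarrow> 'b qspace" where
  "greedy_class scale qnorm e = error_space qnorm (gamma_err scale qnorm e)"

definition embeds :: "'b qspace \<Rightarrow> 'b qspace \<Rightarrow> bool" where
  "embeds X Y \<longleftrightarrow> fst X \<subseteq> fst Y \<and> (\<exists>C>0. \<forall>x\<in>fst X. snd Y x \<le> C * snd X x)"

definition same_space :: "'b qspace \<Rightarrow> 'b qspace \<Rightarrow> bool" where
  "same_space X Y \<longleftrightarrow> embeds X Y \<and> embeds Y X"

end

theory Submission
  imports Defs "HOL-Library.Infinite_Set"
begin

text \<open>Every \<open>x\<close> satisfies \<open>\<sigma>\<^sub>N(x) \<le> \<gamma>\<^sub>N(x)\<close>, so what has to fail is the embedding of the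
  approximation space into the greedy class. The greedy algorithm is misled by a vector whose
  coefficients are all equal: among equal coefficients it may first pick many that contribute
  little to the norm.

  Write \<open>1\<^sub>\<Gamma> = \<Sum>k\<in>\<Gamma>. e k\<close>. For \<open>p\<close> much larger than \<open>q\<close>, let \<open>A\<close> be a set of size \<open>p\<close> with
  \<open>\<parallel>1\<^sub>A\<parallel>\<close> close to \<open>h\<^sub>\<ell>(p)\<close>, and \<open>B\<close> a set of size at most \<open>q\<close>, disjoint from \<open>A\<close>, with \<open>\<parallel>1\<^sub>B\<parallel>\<close>
  comparable to \<open>h\<^sub>r(q)\<close>. Consider \<open>x = 1\<^sub>A + 1\<^sub>B\<close>.
  \<^item> A greedy ordering may list \<open>A\<close> first, and then \<open>\<gamma>\<^sub>N(x) \<ge> \<parallel>1\<^sub>B\<parallel>\<close> for all \<open>N \<le> p\<close>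
    (\<open>gamma_err_sum_ge\<close>). The greedy norm of \<open>x\<close> is therefore at least of order
    \<open>p\<^sup>\<alpha> \<parallel>1\<^sub>B\<parallel>\<close> (\<open>weight_value_ge_block\<close>).
  \<^item> The best approximation may remove \<open>B\<close> first, so \<open>\<sigma>\<^sub>N(x) \<le> \<parallel>1\<^sub>A\<parallel>\<close> for \<open>N > q\<close>, while
    \<open>\<sigma>\<^sub>N(x) \<le> \<parallel>x\<parallel>\<close> always and \<open>\<sigma>\<^sub>N(x) = 0\<close> for \<open>N > p + q\<close> (\<open>sigma_err_sum_le\<close>). The approximation
    norm of \<open>x\<close> is therefore at most of order
    \<open>q\<^sup>\<alpha> \<parallel>1\<^sub>B\<parallel> + p\<^sup>\<alpha> \<parallel>1\<^sub>A\<parallel>\<close> (\<open>weight_value_le_two_blocks\<close>).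

  The quotient of the second bound by the first is of order \<open>(q/p)\<^sup>\<alpha> + \<parallel>1\<^sub>A\<parallel> / \<parallel>1\<^sub>B\<parallel>\<close>. Take
  \<open>p = m q\<close> with \<open>m\<close> a large constant; then both terms are small as soon as \<open>h\<^sub>r(q) / h\<^sub>\<ell>(m q)\<close> is
  large. Under either hypothesis this last quotient is at least a constant depending on \<open>m\<close> times
  \<open>(log q)\<^sup>\<gamma>\<close>, which tends to infinity with \<open>q\<close> (\<open>democracy_gap\<close>).\<close>

section \<open>Power sums and weights of blocks\<close>

text \<open>With \<open>sum_powr_bounds\<close>, this shows that the weights \<open>N\<^sup>t\<^sup>-\<^sup>1\<close> on \<open>{1..n}\<close> have total mass
  comparable to \<open>n\<^sup>t\<close>, by telescoping. One of the two bounds is the mean value theorem; the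
  other compares \<open>k\<^sup>t\<^sup>-\<^sup>1\<close> with \<open>(k + 1)\<^sup>t\<^sup>-\<^sup>1\<close>. They trade places at \<open>t = 1\<close>, where the exponent
  \<open>t - 1\<close> changes sign.\<close>

lemma powr_increment_bounds:
  fixes t :: real
  assumes "t > 0"
  shows "min 1 t * real (Suc k) powr (t - 1) \<le> real (Suc k) powr t - real k powr t"
    and "real (Suc k) powr t - real k powr t \<le> max 1 t * real (Suc k) powr (t - 1)"
proof -
  have top: "real (Suc k) powr t = (real k + 1) * real (Suc k) powr (t - 1)"
    using powr_mult_base[of "real (Suc k)" "t - 1"] by (simp add: algebra_simps)
  have bot: "real k powr t = real k * real k powr (t - 1)"
    by (simp add: powr_mult_base)
  have mv: "\<exists>z>real k. z < real (Suc k) \<and> real (Suc k) powr t - real k powr t = t * z powr (t - 1)"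
    if "k > 0"
  proof -
    have "\<exists>z>real k. z < real (Suc k) \<and>
        real (Suc k) powr t - real k powr t = (real (Suc k) - real k) * (t * z powr (t - 1))"
      using that by (intro MVT2 has_real_derivative_powr) auto
    then show ?thesis by simp
  qed
  have "min 1 t * real (Suc k) powr (t - 1) \<le> real (Suc k) powr t - real k powr t \<and>
        real (Suc k) powr t - real k powr t \<le> max 1 t * real (Suc k) powr (t - 1)"
  proof (cases "k = 0")
    case True
    then show ?thesis using assms by simp
  next
    case k: False
    then obtain z where z: "real k < z" "z < real (Suc k)"
        "real (Suc k) powr t - real k powr t = t * z powr (t - 1)" using mv by blast
    show ?thesis
    proof (cases "t \<ge> 1")
      case True
      have "real k * real k powr (t - 1) \<le> real k * real (Suc k) powr (t - 1)"
        using True by (intro mult_left_mono powr_mono2) auto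
      then have lo: "real (Suc k) powr (t - 1) \<le> real (Suc k) powr t - real k powr t"
        unfolding top bot by (simp add: algebra_simps)
      have "z powr (t - 1) \<le> real (Suc k) powr (t - 1)"
        using True z by (intro powr_mono2) auto
      then show ?thesis using True lo z(3) by (simp add: min_def max_def)
    next
      case False
      have "real k * real (Suc k) powr (t - 1) \<le> real k * real k powr (t - 1)"
        using False k by (intro mult_left_mono powr_mono2') auto
      then have up: "real (Suc k) powr t - real k powr t \<le> real (Suc k) powr (t - 1)"
        unfolding top bot by (simp add: algebra_simps)
      have "real (Suc k) powr (t - 1) \<le> z powr (t - 1)"
        using False z k by (intro powr_mono2') auto
      then show ?thesis using False up z(3) assms by (simp add: min_def max_def)
    qed
  qed
  then show "min 1 t * real (Suc k) powr (t - 1) \<le> real (Suc k) powr t - real k powr t"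
    and "real (Suc k) powr t - real k powr t \<le> max 1 t * real (Suc k) powr (t - 1)" by auto
qed

lemma sum_powr_bounds:
  fixes t :: real
  assumes "t > 0"
  shows "min 1 t * (\<Sum>k<n. real (Suc k) powr (t - 1)) \<le> real n powr t"
    and "real n powr t \<le> max 1 t * (\<Sum>k<n. real (Suc k) powr (t - 1))"
proof -
  have tele: "real n powr t = (\<Sum>k<n. real (Suc k) powr t - real k powr t)"
    using assms by (subst sum_lessThan_telescope) auto
  show "min 1 t * (\<Sum>k<n. real (Suc k) powr (t - 1)) \<le> real n powr t"
    unfolding tele sum_distrib_left by (intro sum_mono powr_increment_bounds assms)
  show "real n powr t \<le> max 1 t * (\<Sum>k<n. real (Suc k) powr (t - 1))"
    unfolding tele sum_distrib_left by (intro sum_mono powr_increment_bounds assms)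
qed

lemma weight_term_eq:
  assumes "y \<ge> 0"
  shows "(real (Suc n) powr \<alpha> * y) powr \<tau> * (1 / real (Suc n)) =
         y powr \<tau> * real (Suc n) powr (\<alpha> * \<tau> - 1)"
  using assms by (simp add: powr_mult powr_powr powr_diff)

text \<open>A block of height \<open>b\<close> on \<open>{1..p}\<close> weighs at least a constant times \<open>b p\<^sup>\<alpha>\<close>; what matters
  later is that the constant depends on \<open>\<alpha>\<close> and \<open>\<tau>\<close> only.\<close>

lemma weight_value_ge_block:
  assumes "\<alpha> > 0" and "\<tau> > 0"
  shows "\<exists>c>0. \<forall>s b p. weight_finite \<alpha> \<tau> s \<longrightarrow> 0 \<le> b \<longrightarrow> 1 \<le> p \<longrightarrow>
           (\<forall>N. 1 \<le> N \<longrightarrow> N \<le> p \<longrightarrow> b \<le> s N) \<longrightarrow>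
           c * (b * real p powr \<alpha>) \<le> weight_value \<alpha> \<tau> s"
proof (cases "\<tau> = \<infinity>")
  case True
  show ?thesis
  proof (intro exI[of _ 1] conjI allI impI)
    fix s b p
    assume fin: "weight_finite \<alpha> \<tau> s" and "0 \<le> b" and p: "1 \<le> (p::nat)"
      and b: "\<forall>N. 1 \<le> N \<longrightarrow> N \<le> p \<longrightarrow> b \<le> s N"
    have "b * real p powr \<alpha> \<le> real p powr \<alpha> * s p"
      using b p by (simp add: mult.commute mult_right_mono)
    also have "\<dots> \<le> (SUP N\<in>{1..}. real N powr \<alpha> * s N)"
      using fin True p by (intro cSUP_upper) (auto simp: weight_finite_def)
    finally show "1 * (b * real p powr \<alpha>) \<le> weight_value \<alpha> \<tau> s"
      using True by (simp add: weight_value_def)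
  qed simp
next
  case False
  define T where "T = real_of_ereal \<tau>"
  have T: "T > 0"
    using False assms(2) unfolding T_def by (cases \<tau>) auto
  define t where "t = \<alpha> * T"
  have t: "t > 0" using assms(1) T by (simp add: t_def)
  define c where "c = (1 / max 1 t) powr (1 / T)"
  show ?thesis
  proof (intro exI[of _ c] conjI allI impI)
    show "c > 0" using t by (simp add: c_def)
    fix s b p
    assume fin: "weight_finite \<alpha> \<tau> s" and b0: "0 \<le> b" and p: "1 \<le> (p::nat)"
      and b: "\<forall>N. 1 \<le> N \<longrightarrow> N \<le> p \<longrightarrow> b \<le> s N"
    define f where "f n = (real (Suc n) powr \<alpha> * s (Suc n)) powr T * (1 / real (Suc n))" for n
    have summ: "summable f"
      using fin False by (simp add: weight_finite_def f_def[abs_def] T_def)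
    have "1 / max 1 t * real p powr t \<le> (\<Sum>k<p. real (Suc k) powr (t - 1))"
      using sum_powr_bounds(2)[OF t, of p] t by (simp add: field_simps)
    then have "b powr T * (1 / max 1 t * real p powr t) \<le> b powr T * (\<Sum>k<p. real (Suc k) powr (t - 1))"
      by (intro mult_left_mono) auto
    also have "\<dots> = (\<Sum>k<p. (real (Suc k) powr \<alpha> * b) powr T * (1 / real (Suc k)))"
      unfolding weight_term_eq[OF b0] t_def sum_distrib_left ..
    also have "\<dots> \<le> (\<Sum>k<p. f k)"
      unfolding f_def using b b0 T
      by (intro sum_mono mult_right_mono powr_mono2 mult_left_mono) auto
    also have "\<dots> \<le> suminf f"
      by (intro sum_le_suminf summ) (auto simp: f_def)
    finally have main: "b powr T * (1 / max 1 t * real p powr t) \<le> suminf f" .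
    have "c * (b * real p powr \<alpha>) = (b powr T * (1 / max 1 t * real p powr t)) powr (1 / T)"
      using b0 T t by (simp add: c_def t_def powr_mult powr_powr powr_divide)
    also have "\<dots> \<le> suminf f powr (1 / T)"
      using main T b0 t by (intro powr_mono2) auto
    finally show "c * (b * real p powr \<alpha>) \<le> weight_value \<alpha> \<tau> s"
      using False by (simp add: weight_value_def f_def[abs_def] T_def)
  qed
qed

text \<open>A sequence below a staircase of height \<open>X\<close> up to \<open>q\<close> and height \<open>a\<close> up to \<open>n\<close> weighs no more
  than the two blocks together, again up to a constant depending on \<open>\<alpha>\<close> and \<open>\<tau>\<close> only. For finite
  \<open>\<tau>\<close> the triangle inequality may fail (\<open>\<tau> < 1\<close>); the bound is obtained for the \<open>\<tau>\<close>-th powers,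
  which are additive over blocks.\<close>

lemma weight_value_le_two_blocks:
  assumes "\<alpha> > 0" and "\<tau> > 0"
  shows "\<exists>D>0. \<forall>s X a q n. (\<forall>N. 0 \<le> s N) \<longrightarrow> 0 \<le> X \<longrightarrow> 0 \<le> a \<longrightarrow> q \<le> n \<longrightarrow>
           (\<forall>N\<le>q. s N \<le> X) \<longrightarrow> (\<forall>N>q. s N \<le> a) \<longrightarrow> (\<forall>N>n. s N = 0) \<longrightarrow>
           weight_finite \<alpha> \<tau> s \<and>
           weight_value \<alpha> \<tau> s \<le> D * (X * real q powr \<alpha> + a * real n powr \<alpha>)"
proof (cases "\<tau> = \<infinity>")
  case True
  show ?thesis
  proof (intro exI[of _ 1] conjI[of "0 < (1::real)"] allI impI)
    fix s :: "nat \<Rightarrow> real" and X a :: real and q n :: nat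
    assume s0: "\<forall>N. 0 \<le> s N" and X: "0 \<le> X" and a: "0 \<le> a" and "q \<le> n"
      and sX: "\<forall>N\<le>q. s N \<le> X" and sa: "\<forall>N>q. s N \<le> a" and sn: "\<forall>N>n. s N = 0"
    have bd: "real N powr \<alpha> * s N \<le> X * real q powr \<alpha> + a * real n powr \<alpha>" for N
    proof -
      consider "N \<le> q" | "q < N" "N \<le> n" | "n < N" by linarith
      then show ?thesis
      proof cases
        case 1
        then have "real N powr \<alpha> * s N \<le> real q powr \<alpha> * X"
          using sX s0 X assms(1) by (intro mult_mono powr_mono2) auto
        then show ?thesis using a by (simp add: mult.commute add_increasing2)
      next
        case 2
        then have "real N powr \<alpha> * s N \<le> real n powr \<alpha> * a"
          using sa s0 a assms(1) by (intro mult_mono powr_mono2) auto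
        then show ?thesis using X by (simp add: mult.commute add_increasing)
      next
        case 3
        then show ?thesis using sn X a by simp
      qed
    qed
    show "weight_finite \<alpha> \<tau> s \<and>
        weight_value \<alpha> \<tau> s \<le> 1 * (X * real q powr \<alpha> + a * real n powr \<alpha>)"
      using True bd by (auto simp: weight_finite_def weight_value_def bdd_above_def intro!: cSUP_least)
  qed simp
next
  case False
  define T where "T = real_of_ereal \<tau>"
  have T: "T > 0"
    using False assms(2) unfolding T_def by (cases \<tau>) auto
  define t where "t = \<alpha> * T"
  have t: "t > 0" using assms(1) T by (simp add: t_def)
  define S where "S n = (\<Sum>k<n. real (Suc k) powr (t - 1))" for n
  define d where "d = 1 / min 1 t"
  have d: "d > 0" using t by (simp add: d_def)
  have S: "S n \<le> d * real n powr t" for n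
    using sum_powr_bounds(1)[OF t, of n] t by (simp add: S_def d_def field_simps min_def)
  define D where "D = (2 * d) powr (1 / T)"
  show ?thesis
  proof (intro exI[of _ D] conjI[of "0 < D"] allI impI)
    show "D > 0" using d by (simp add: D_def)
    fix s :: "nat \<Rightarrow> real" and X a :: real and q n :: nat
    assume s0: "\<forall>N. 0 \<le> s N" and X: "0 \<le> X" and a: "0 \<le> a" and qn: "q \<le> n"
      and sX: "\<forall>N\<le>q. s N \<le> X" and sa: "\<forall>N>q. s N \<le> a" and sn: "\<forall>N>n. s N = 0"
    define f where "f n = (real (Suc n) powr \<alpha> * s (Suc n)) powr T * (1 / real (Suc n))" for n
    have f0: "f k = 0" if "k \<notin> {..<n}" for k
      using that sn by (simp add: f_def)
    have f_eq: "f k = s (Suc k) powr T * real (Suc k) powr (t - 1)" for k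
      using weight_term_eq[of "s (Suc k)" k \<alpha> T] s0 by (simp add: f_def t_def)
    have "suminf f = (\<Sum>k<n. f k)"
      by (intro suminf_finite f0) auto
    also have "\<dots> \<le> (\<Sum>k<n. (if k < q then X powr T * real (Suc k) powr (t - 1) else 0) +
                        a powr T * real (Suc k) powr (t - 1))"
    proof (rule sum_mono)
      fix k
      show "f k \<le> (if k < q then X powr T * real (Suc k) powr (t - 1) else 0) +
                a powr T * real (Suc k) powr (t - 1)"
      proof (cases "k < q")
        case True
        have "f k \<le> X powr T * real (Suc k) powr (t - 1)"
          unfolding f_eq using True sX s0 T by (intro mult_right_mono powr_mono2) auto
        then show ?thesis using True by (simp add: add_increasing2)
      next
        case False
        have "f k \<le> a powr T * real (Suc k) powr (t - 1)"
          unfolding f_eq using False sa s0 T by (intro mult_right_mono powr_mono2) auto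
        then show ?thesis using False by simp
      qed
    qed
    also have "\<dots> = X powr T * S q + a powr T * S n"
    proof -
      have "{..<n} \<inter> {k. k < q} = {..<q}" using qn by auto
      then show ?thesis
        by (simp add: sum.distrib S_def sum_distrib_left sum.If_cases)
    qed
    also have "\<dots> \<le> X powr T * (d * real q powr t) + a powr T * (d * real n powr t)"
      by (intro add_mono mult_left_mono S) auto
    also have "\<dots> = d * ((X * real q powr \<alpha>) powr T + (a * real n powr \<alpha>) powr T)"
      using X a by (simp add: powr_mult powr_powr t_def algebra_simps)
    also have "\<dots> \<le> d * ((X * real q powr \<alpha> + a * real n powr \<alpha>) powr T +
                        (X * real q powr \<alpha> + a * real n powr \<alpha>) powr T)"
      using d X a T by (intro mult_left_mono add_mono powr_mono2) auto
    finally have le: "suminf f \<le> 2 * d * (X * real q powr \<alpha> + a * real n powr \<alpha>) powr T"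
      by simp
    have summ: "summable f" by (rule summable_finite[of "{..<n}"]) (use f0 in auto)
    have "0 \<le> suminf f" by (intro suminf_nonneg summ) (auto simp: f_def)
    then have "suminf f powr (1 / T) \<le>
        (2 * d * (X * real q powr \<alpha> + a * real n powr \<alpha>) powr T) powr (1 / T)"
      using le T by (intro powr_mono2) auto
    also have "\<dots> = D * (X * real q powr \<alpha> + a * real n powr \<alpha>)"
      using T d X a by (simp add: D_def powr_mult powr_powr)
    finally show "weight_finite \<alpha> \<tau> s \<and>
        weight_value \<alpha> \<tau> s \<le> D * (X * real q powr \<alpha> + a * real n powr \<alpha>)"
      using False summ by (simp add: weight_finite_def weight_value_def f_def[abs_def] T_def)
  qed
qed

lemma powr_real_at_top:
  fixes \<alpha> :: real
  assumes "\<alpha> > 0"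
  shows "filterlim (\<lambda>x. x powr \<alpha>) at_top at_top"
proof -
  have "filterlim (\<lambda>x. exp (\<alpha> * ln x)) at_top at_top"
    using assms
    by (intro filterlim_compose[OF exp_at_top]
        filterlim_tendsto_pos_mult_at_top[OF tendsto_const _ ln_at_top])
  moreover have "\<forall>\<^sub>F x in at_top. exp (\<alpha> * ln x) = x powr \<alpha>"
    using eventually_gt_at_top[of 0] by eventually_elim (simp add: powr_def)
  ultimately show ?thesis by (rule filterlim_cong[OF refl refl, THEN iffD1, rotated])
qed

section \<open>Indicator sums over an unconditional basis\<close>

lemma (in quasi_banach_space) qnorm_add_le_max:
  "qnorm (x + y) \<le> 2 powr (1 / \<rho>) * max (qnorm x) (qnorm y)"
proof -
  define m where "m = max (qnorm x) (qnorm y)"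
  have m: "m \<ge> 0" using qnorm_nonneg[of x] by (simp add: m_def)
  have "qnorm (x + y) powr \<rho> \<le> m powr \<rho> + m powr \<rho>"
    using qnorm_add[of x y] rho_pos qnorm_nonneg
    by (smt (verit) m_def max.cobounded1 max.cobounded2 powr_mono2)
  then have "(qnorm (x + y) powr \<rho>) powr (1 / \<rho>) \<le> (2 * m powr \<rho>) powr (1 / \<rho>)"
    using rho_pos by (intro powr_mono2) auto
  then show ?thesis
    using rho_pos m qnorm_nonneg by (simp add: powr_powr powr_mult m_def)
qed

locale quasi_banach_unconditional_basis = quasi_banach_space scale qnorm \<rho>
  for scale :: "'k::real_normed_field \<Rightarrow> 'b::ab_group_add \<Rightarrow> 'b"
    and qnorm :: "'b \<Rightarrow> real" and \<rho> :: real +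
  fixes e :: "nat \<Rightarrow> 'b"
  assumes unconditional: "unconditional_basis scale qnorm e 1"
begin

text \<open>The partial sums are eventually constant, so convergence to \<open>x\<close> means that the constant
  \<open>qnorm (x - sum e \<Gamma>)\<close> is \<open>0\<close>.\<close>

lemma converges_indicator_iff:
  assumes "finite \<Gamma>"
  shows "series_converges_to scale qnorm e (\<lambda>j. if j \<in> \<Gamma> then 1 else 0) x \<longleftrightarrow> x = sum e \<Gamma>"
proof -
  obtain M where M: "\<Gamma> \<subseteq> {..<M}"
    using assms finite_nat_bounded by blast
  have "(\<Sum>j<n. scale (if j \<in> \<Gamma> then 1 else 0) (e j)) = sum e \<Gamma>" if "n \<ge> M" for n
  proof -
    have "(\<Sum>j<n. scale (if j \<in> \<Gamma> then 1 else 0) (e j)) = (\<Sum>j<n. if j \<in> \<Gamma> then e j else 0)"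
      by (intro sum.cong) auto
    also have "\<dots> = sum e ({..<n} \<inter> \<Gamma>)" by (simp add: sum.inter_restrict)
    also have "{..<n} \<inter> \<Gamma> = \<Gamma>" using M that by auto
    finally show ?thesis .
  qed
  then have ev: "\<forall>\<^sub>F n in sequentially.
      qnorm (x - (\<Sum>j<n. scale (if j \<in> \<Gamma> then 1 else 0) (e j))) = qnorm (x - sum e \<Gamma>)"
    unfolding eventually_sequentially by (metis (no_types, lifting))
  show ?thesis
    unfolding series_converges_to_def tendsto_cong[OF ev]
    by (simp add: LIMSEQ_const_iff qnorm_eq_0_iff)
qed

lemma basis_coeff_sum:
  assumes "finite \<Gamma>"
  shows "basis_coeff scale qnorm e (sum e \<Gamma>) = (\<lambda>j. if j \<in> \<Gamma> then 1 else 0)"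
proof -
  have "\<exists>!c. series_converges_to scale qnorm e c (sum e \<Gamma>)"
    using unconditional by (simp add: unconditional_basis_def is_basis_def)
  then show ?thesis
    unfolding basis_coeff_def
    by (rule the1_equality) (simp add: converges_indicator_iff[OF assms])
qed

lemma qnorm_sum_mono:
  assumes "finite \<Gamma>" and "\<Delta> \<subseteq> \<Gamma>"
  shows "qnorm (sum e \<Delta>) \<le> qnorm (sum e \<Gamma>)"
proof -
  define l :: "nat \<Rightarrow> 'k" where "l = (\<lambda>j. if j \<in> \<Delta> then 1 else 0)"
  have "series_converges_to scale qnorm e (\<lambda>j. if j \<in> \<Gamma> then 1 else 0) (sum e \<Gamma>) \<and>
      (\<forall>j. norm (l j) \<le> 1)"
    using assms(1) by (simp add: converges_indicator_iff l_def)
  then obtain y where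
    y: "series_converges_to scale qnorm e (\<lambda>j. l j * (if j \<in> \<Gamma> then 1 else 0)) y"
       "qnorm y \<le> 1 * qnorm (sum e \<Gamma>)"
    using unconditional unfolding unconditional_basis_def by blast
  have "(\<lambda>j. l j * (if j \<in> \<Gamma> then 1 else 0)) = (\<lambda>j. if j \<in> \<Delta> then 1 else 0)"
    using assms(2) by (auto simp: l_def fun_eq_iff)
  then have "y = sum e \<Delta>"
    using y(1) finite_subset[OF assms(2,1)] by (simp add: converges_indicator_iff)
  then show ?thesis using y(2) by simp
qed

lemma sum_in_sparse_vectors:
  assumes "finite \<Gamma>" and "card \<Gamma> \<le> N"
  shows "sum e \<Gamma> \<in> sparse_vectors scale qnorm e N"
  using assms by (simp add: sparse_vectors_def basis_coeff_sum)

lemma sigma_err_nonneg: "0 \<le> sigma_err scale qnorm e x N"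
proof -
  have "sparse_vectors scale qnorm e N \<noteq> {}"
    using sum_in_sparse_vectors[of "{}" N] by auto
  then show ?thesis
    unfolding sigma_err_def by (intro cINF_greatest) (auto simp: qnorm_nonneg)
qed

lemma sigma_err_sum_le:
  assumes "finite \<Gamma>" and "\<Delta> \<subseteq> \<Gamma>" and "card \<Delta> \<le> N"
  shows "sigma_err scale qnorm e (sum e \<Gamma>) N \<le> qnorm (sum e (\<Gamma> - \<Delta>))"
proof -
  have "sigma_err scale qnorm e (sum e \<Gamma>) N \<le> qnorm (sum e \<Gamma> - sum e \<Delta>)"
    unfolding sigma_err_def using assms
    by (intro cINF_lower sum_in_sparse_vectors bdd_belowI2[where m = 0] qnorm_nonneg)
       (auto intro: finite_subset)
  then show ?thesis using assms by (simp add: sum_diff)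
qed

lemma greedy_remainder_sum:
  assumes "finite \<Gamma>" and "inj \<pi>"
  shows "sum e \<Gamma> - greedy_sum scale qnorm e \<pi> N (sum e \<Gamma>) = sum e (\<Gamma> - \<pi> ` {..<N})"
proof -
  have "greedy_sum scale qnorm e \<pi> N (sum e \<Gamma>) =
      (\<Sum>j<N. if \<pi> j \<in> \<Gamma> then e (\<pi> j) else 0)"
    unfolding greedy_sum_def basis_coeff_sum[OF assms(1)] by (intro sum.cong) auto
  also have "\<dots> = (\<Sum>i\<in>\<pi> ` {..<N}. if i \<in> \<Gamma> then e i else 0)"
    using assms(2) by (subst sum.reindex) (auto intro: inj_on_subset)
  also have "\<dots> = sum e (\<pi> ` {..<N} \<inter> \<Gamma>)" by (simp add: sum.inter_restrict)
  finally have "greedy_sum scale qnorm e \<pi> N (sum e \<Gamma>) = sum e (\<Gamma> \<inter> \<pi> ` {..<N})"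
    by (simp add: Int_commute)
  then show ?thesis using assms(1) by (simp add: sum_diff[symmetric] Diff_Int)
qed

text \<open>All nonzero coefficients of \<open>1\<^sub>A + 1\<^sub>B\<close> are equal, so listing \<open>A\<close>, then \<open>B\<close>, then all other
  indices is a greedy ordering. Its remainder after \<open>N \<le> card A\<close> steps still contains \<open>1\<^sub>B\<close>, and
  dropping the rest of \<open>A\<close> does not increase the norm.\<close>

lemma gamma_err_sum_ge:
  assumes "finite A" and "finite B" and "A \<inter> B = {}" and "N \<le> card A"
  shows "qnorm (sum e B) \<le> gamma_err scale qnorm e (sum e (A \<union> B)) N"
proof -
  let ?\<Gamma> = "A \<union> B"
  define L where "L = sorted_list_of_set A @ sorted_list_of_set B"
  have dL: "distinct L" and sL: "set L = ?\<Gamma>" and lA: "length L \<ge> card A"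
    using assms by (auto simp: L_def)
  define \<pi> where "\<pi> j = (if j < length L then L ! j else enumerate (- ?\<Gamma>) (j - length L))" for j
  have inf: "infinite (- ?\<Gamma>)" using assms infinite_UNIV_nat by (simp only: finite_compl finite_Un simp_thms)
  have mem: "\<pi> j \<in> ?\<Gamma> \<longleftrightarrow> j < length L" for j
    using enumerate_in_set[OF inf, of "j - length L"] sL[symmetric]
    by (auto simp: \<pi>_def)
  have inj: "inj \<pi>"
  proof (rule injI)
    fix i j assume eq: "\<pi> i = \<pi> j"
    then have iff: "i < length L \<longleftrightarrow> j < length L" using mem by metis
    show "i = j"
    proof (cases "i < length L")
      case True
      then show ?thesis using eq iff dL by (simp add: \<pi>_def nth_eq_iff_index_eq)
    next
      case False
      then have "i - length L = j - length L"
        using eq iff inj_enumerate[OF inf] by (simp add: \<pi>_def inj_eq)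
      then show ?thesis using False iff by simp
    qed
  qed
  have sub: "?\<Gamma> \<subseteq> range \<pi>"
  proof
    fix x assume "x \<in> ?\<Gamma>"
    then obtain j where "j < length L" "L ! j = x" using sL by (metis in_set_conv_nth)
    then have "\<pi> j = x" by (simp add: \<pi>_def)
    then show "x \<in> range \<pi>" by blast
  qed
  have greedy: "greedy_ordering (basis_coeff scale qnorm e (sum e ?\<Gamma>)) \<pi>"
    unfolding greedy_ordering_def using assms inj sub mem
    by (auto simp: basis_coeff_sum)
  have "\<pi> ` {..<N} \<subseteq> A"
  proof
    fix x assume "x \<in> \<pi> ` {..<N}"
    then obtain j where j: "j < N" "x = \<pi> j" by auto
    then have "x = sorted_list_of_set A ! j"
      using assms(4) lA by (simp add: \<pi>_def L_def nth_append)
    then show "x \<in> A" using j(1) assms(1,4)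
      by (metis length_sorted_list_of_set nth_mem order_less_le_trans set_sorted_list_of_set)
  qed
  then have "qnorm (sum e B) \<le> qnorm (sum e (?\<Gamma> - \<pi> ` {..<N}))"
    using assms by (intro qnorm_sum_mono) auto
  also have "\<dots> = qnorm (sum e ?\<Gamma> - greedy_sum scale qnorm e \<pi> N (sum e ?\<Gamma>))"
    using greedy_remainder_sum[of ?\<Gamma> \<pi> N] assms inj by simp
  also have "\<dots> \<le> gamma_err scale qnorm e (sum e ?\<Gamma>) N"
    unfolding gamma_err_def
    \<comment> \<open>Every greedy remainder is the sum over a subset of \<open>A \<union> B\<close>, so the supremum is over a
      bounded set and does bound its members.\<close>
  proof (intro cSUP_upper bdd_aboveI2[where M = "qnorm (sum e ?\<Gamma>)"])
    fix \<pi>' assume "\<pi>' \<in> {\<pi>. greedy_ordering (basis_coeff scale qnorm e (sum e ?\<Gamma>)) \<pi>}"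
    then show "qnorm (sum e ?\<Gamma> - greedy_sum scale qnorm e \<pi>' N (sum e ?\<Gamma>)) \<le> qnorm (sum e ?\<Gamma>)"
      using assms by (subst greedy_remainder_sum) (auto simp: greedy_ordering_def intro!: qnorm_sum_mono)
  qed (use greedy in simp)
  finally show ?thesis .
qed

section \<open>Failure of the embedding\<close>

text \<open>The nearly extremal sets \<open>A\<close> for \<open>h\<^sub>\<ell>(p)\<close> and \<open>R\<close> for \<open>h\<^sub>r(q)\<close> may overlap. Replacing \<open>R\<close>
  by \<open>R - A\<close> is harmless: the lost part \<open>1\<^bsub>R \<inter> A\<^esub>\<close> is bounded by \<open>\<parallel>1\<^sub>A\<parallel>\<close>, which is far too small
  to account for \<open>\<parallel>1\<^sub>R\<parallel>\<close>. The factor \<open>2 powr (1 / \<rho>)\<close> is the price of the quasi-triangle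
  inequality when \<open>1\<^sub>R\<close> is split.\<close>

lemma obtain_disjoint_extremal_sets:
  assumes "1 \<le> M" and "2 powr (1 / \<rho>) * M * h_l qnorm e p < h_r qnorm e q"
  obtains A B where "finite A" "finite B" "A \<inter> B = {}" "card A = p" "card B \<le> q"
    "M * qnorm (sum e A) < qnorm (sum e B)"
proof -
  define \<kappa> where "\<kappa> = 2 powr (1 / \<rho>)"
  have \<kappa>: "\<kappa> > 0" by (simp add: \<kappa>_def)
  have ne: "{\<Gamma>::nat set. finite \<Gamma> \<and> card \<Gamma> = n} \<noteq> {}" for n
    using card_lessThan[of n] finite_lessThan by blast
  obtain R where R: "finite R" "card R = q" "\<kappa> * M * h_l qnorm e p < qnorm (sum e R)"
    using less_cSupD[OF _ assms(2)[unfolded h_r_def]] ne by (auto simp: \<kappa>_def)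
  have "h_l qnorm e p < qnorm (sum e R) / (\<kappa> * M)"
    using R(3) \<kappa> assms(1) by (simp add: field_simps)
  then have "\<exists>y\<in>(\<lambda>\<Gamma>. qnorm (sum e \<Gamma>)) ` {\<Gamma>. finite \<Gamma> \<and> card \<Gamma> = p}.
      y < qnorm (sum e R) / (\<kappa> * M)"
    unfolding h_l_def using ne by (intro cInf_lessD) auto
  then obtain A where A: "finite A" "card A = p" "qnorm (sum e A) < qnorm (sum e R) / (\<kappa> * M)"
    by auto
  define B where "B = R - A"
  have "qnorm (sum e R) = qnorm (sum e B + sum e (R \<inter> A))"
    unfolding B_def using sum.Int_Diff[OF R(1), of e A] by (simp add: add.commute)
  also have "\<dots> \<le> \<kappa> * max (qnorm (sum e B)) (qnorm (sum e (R \<inter> A)))"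
    unfolding \<kappa>_def by (rule qnorm_add_le_max)
  also have "\<dots> \<le> \<kappa> * max (qnorm (sum e B)) (qnorm (sum e A))"
    using \<kappa> A(1) qnorm_sum_mono[of A "R \<inter> A"] by (intro mult_left_mono max.mono) auto
  finally have "qnorm (sum e R) \<le> \<kappa> * max (qnorm (sum e B)) (qnorm (sum e A))" .
  moreover have "\<kappa> * (M * qnorm (sum e A)) < qnorm (sum e R)"
    using A(3) \<kappa> assms(1) by (simp add: field_simps)
  ultimately have "M * qnorm (sum e A) < max (qnorm (sum e B)) (qnorm (sum e A))"
    using \<kappa> by (metis mult_less_cancel_left_pos order_less_le_trans)
  moreover have "qnorm (sum e A) \<le> M * qnorm (sum e A)"
    using assms(1) qnorm_nonneg[of "sum e A"] by (simp add: mult_le_cancel_right1)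
  ultimately have "M * qnorm (sum e A) < qnorm (sum e B)" by linarith
  moreover have "card B \<le> q" unfolding B_def using R card_mono[of R "R - A"] by auto
  ultimately show thesis using that[of A B] A R(1) by (auto simp: B_def)
qed

text \<open>Some factor between \<open>p\<close> and \<open>q\<close> is needed besides a gap between \<open>h\<^sub>\<ell>\<close> and \<open>h\<^sub>r\<close>: the first
  \<open>q\<close> terms may contribute an amount of order \<open>q\<^sup>\<alpha> \<parallel>1\<^sub>B\<parallel>\<close> to both norms. Hence the gap is required for \<open>h\<^sub>\<ell>(m q)\<close>
  against \<open>h\<^sub>r(q)\<close> with every constant \<open>m\<close>.\<close>

lemma not_approx_embeds_greedy:
  assumes gap: "\<And>(m::nat) (M::real). 1 \<le> m \<Longrightarrow> 1 \<le> M \<Longrightarrow>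
      \<exists>q\<ge>1. M * h_l qnorm e (m * q) < h_r qnorm e q"
    and \<alpha>: "\<alpha> > 0" and \<tau>: "\<tau> > 0"
  shows "\<not> embeds (approx_space scale qnorm e \<alpha> \<tau>) (greedy_class scale qnorm e \<alpha> \<tau>)"
proof
  assume emb: "embeds (approx_space scale qnorm e \<alpha> \<tau>) (greedy_class scale qnorm e \<alpha> \<tau>)"
  let ?sig = "sigma_err scale qnorm e" and ?gam = "gamma_err scale qnorm e"
  obtain K where K: "K > 0" and
    emb': "\<And>x. weight_finite \<alpha> \<tau> (?sig x) \<Longrightarrow> weight_finite \<alpha> \<tau> (?gam x) \<and>
      qnorm x + weight_value \<alpha> \<tau> (?gam x) \<le> K * (qnorm x + weight_value \<alpha> \<tau> (?sig x))"
    using emb by (auto simp: embeds_def approx_space_def greedy_class_def error_space_def)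
  obtain c where c: "c > 0" and
    lower: "\<And>s b p. weight_finite \<alpha> \<tau> s \<Longrightarrow> 0 \<le> b \<Longrightarrow> 1 \<le> p \<Longrightarrow>
      (\<And>N. 1 \<le> N \<Longrightarrow> N \<le> p \<Longrightarrow> b \<le> s N) \<Longrightarrow> c * (b * real p powr \<alpha>) \<le> weight_value \<alpha> \<tau> s"
    using weight_value_ge_block[OF \<alpha> \<tau>] by blast
  obtain D where D: "D > 0" and
    upper: "\<And>s X a q n. (\<And>N. 0 \<le> s N) \<Longrightarrow> 0 \<le> X \<Longrightarrow> 0 \<le> a \<Longrightarrow> q \<le> n \<Longrightarrow>
      (\<And>N. N \<le> q \<Longrightarrow> s N \<le> X) \<Longrightarrow> (\<And>N. q < N \<Longrightarrow> s N \<le> a) \<Longrightarrow> (\<And>N. n < N \<Longrightarrow> s N = 0) \<Longrightarrow>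
      weight_finite \<alpha> \<tau> s \<and> weight_value \<alpha> \<tau> s \<le> D * (X * real q powr \<alpha> + a * real n powr \<alpha>)"
    using weight_value_le_two_blocks[OF \<alpha> \<tau>] by metis
  define \<kappa> where "\<kappa> = 2 powr (1 / \<rho>)"
  have \<kappa>: "\<kappa> \<ge> 1" using rho_pos by (simp add: \<kappa>_def ge_one_powr_ge_zero)
  \<comment> \<open>The choice of \<open>m\<close> makes \<open>K\<close> times the contribution of \<open>\<parallel>x\<parallel>\<close> and of the first \<open>q\<close> terms to
    the approximation norm less than half of the lower bound for the greedy norm; the choice of
    \<open>M\<close> does the same for the remaining terms, the factor \<open>2 powr \<alpha>\<close> coming from \<open>p + q \<le> 2 * p\<close>.\<close>
  obtain m :: nat where m: "1 \<le> m" "2 * K * (1 + D) * \<kappa> < c * real m powr \<alpha>"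
  proof -
    have "filterlim (\<lambda>m. real m powr \<alpha>) at_top sequentially"
      using \<alpha> by (intro filterlim_compose[OF powr_real_at_top] filterlim_real_sequentially) auto
    then have "\<forall>\<^sub>F m in sequentially. 2 * K * (1 + D) * \<kappa> / c < real m powr \<alpha>"
      by (simp add: filterlim_at_top_dense)
    then have "\<forall>\<^sub>F m in sequentially. 1 \<le> m \<and> 2 * K * (1 + D) * \<kappa> / c < real m powr \<alpha>"
      using eventually_ge_at_top[of 1] by eventually_elim auto
    then obtain m where "1 \<le> m" "2 * K * (1 + D) * \<kappa> / c < real m powr \<alpha>"
      using eventually_happens sequentially_bot by blast
    then show thesis using that[of m] c by (simp add: field_simps)
  qed
  define M where "M = max 1 (2 * K * D * 2 powr \<alpha> / c)"
  have M: "1 \<le> M" "2 * K * D * 2 powr \<alpha> \<le> c * M"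
    using c by (auto simp: M_def max_def field_simps)
  have "1 \<le> \<kappa> * M" using mult_mono[OF \<kappa> M(1)] \<kappa> by simp
  then obtain q where q: "1 \<le> q" "\<kappa> * M * h_l qnorm e (m * q) < h_r qnorm e q"
    using gap[OF m(1)] by blast
  define p where "p = m * q"
  have pq: "q \<le> p" "1 \<le> p" using q(1) m(1) by (auto simp: p_def)
  obtain A B where AB: "finite A" "finite B" "A \<inter> B = {}" "card A = p" "card B \<le> q"
    "M * qnorm (sum e A) < qnorm (sum e B)"
    using obtain_disjoint_extremal_sets[OF M(1) q(2)[unfolded \<kappa>_def, folded p_def]] .
  define x where "x = sum e (A \<union> B)"
  define a where "a = qnorm (sum e A)"
  define b where "b = qnorm (sum e B)"
  have a0: "0 \<le> a" by (simp add: a_def qnorm_nonneg)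
  have ab: "M * a < b" using AB(6) by (simp add: a_def b_def)
  have "a \<le> M * a" using a0 M(1) by (simp add: mult_le_cancel_right1)
  then have b0: "0 < b" and "a \<le> b" using ab a0 by auto
  have "qnorm x \<le> \<kappa> * max a b"
    using qnorm_add_le_max[of "sum e A" "sum e B"] AB by (simp add: x_def a_def b_def \<kappa>_def sum.union_disjoint)
  then have X: "qnorm x \<le> \<kappa> * b" using \<open>a \<le> b\<close> by (simp add: max_def)
  have sX: "?sig x N \<le> \<kappa> * b" for N
    using sigma_err_sum_le[of "A \<union> B" "{}" N] AB X by (simp add: x_def)
  have sa: "?sig x N \<le> a" if "q < N" for N
  proof -
    have "A \<union> B - B = A" using AB by auto
    then show ?thesis
      using sigma_err_sum_le[of "A \<union> B" B N] AB that by (simp add: x_def a_def)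
  qed
  have s0: "?sig x N = 0" if "p + q < N" for N
  proof -
    have "card (A \<union> B) \<le> N" using AB that card_Un_le[of A B] by linarith
    then have "?sig x N \<le> qnorm 0"
      using sigma_err_sum_le[of "A \<union> B" "A \<union> B" N] AB by (simp add: x_def)
    then show ?thesis using sigma_err_nonneg[of x N] qnorm_eq_0_iff[of 0] by simp
  qed
  have sig: "weight_finite \<alpha> \<tau> (?sig x)"
    "weight_value \<alpha> \<tau> (?sig x) \<le> D * (\<kappa> * b * real q powr \<alpha> + a * real (p + q) powr \<alpha>)"
    using upper[of "?sig x" "\<kappa> * b" a q "p + q"] sigma_err_nonneg sX sa s0 a0 b0 \<kappa> by auto
  have gam: "c * (b * real p powr \<alpha>) \<le> weight_value \<alpha> \<tau> (?gam x)"
    using emb'[OF sig(1)] b0 pq AB by (intro lower) (auto simp: x_def b_def intro!: gamma_err_sum_ge)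
  define P where "P = real p powr \<alpha>"
  define Q where "Q = real q powr \<alpha>"
  have P: "P = real m powr \<alpha> * Q" by (simp add: P_def Q_def p_def powr_mult)
  have Q1: "1 \<le> Q" using q(1) \<alpha> by (simp add: Q_def ge_one_powr_ge_zero)
  have pqP: "real (p + q) powr \<alpha> \<le> 2 powr \<alpha> * P"
  proof -
    have "real (p + q) powr \<alpha> \<le> (2 * real p) powr \<alpha>"
      using pq \<alpha> by (intro powr_mono2) auto
    then show ?thesis by (simp add: P_def powr_mult)
  qed
  have "c * (b * P) \<le> qnorm x + weight_value \<alpha> \<tau> (?gam x)"
    using gam qnorm_nonneg[of x] by (simp add: P_def)
  also have "\<dots> \<le> K * (qnorm x + weight_value \<alpha> \<tau> (?sig x))"
    using emb'[OF sig(1)] by simp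
  also have "\<dots> \<le> K * (\<kappa> * b * Q + D * (\<kappa> * b * Q + a * (2 powr \<alpha> * P)))"
  proof (intro mult_left_mono add_mono)
    have "\<kappa> * b * 1 \<le> \<kappa> * b * Q" using Q1 \<kappa> b0 by (intro mult_left_mono) auto
    then show "qnorm x \<le> \<kappa> * b * Q" using X by simp
    have "a * real (p + q) powr \<alpha> \<le> a * (2 powr \<alpha> * P)"
      using pqP a0 by (rule mult_left_mono)
    then show "weight_value \<alpha> \<tau> (?sig x) \<le> D * (\<kappa> * b * Q + a * (2 powr \<alpha> * P))"
      using sig(2) D unfolding Q_def[symmetric]
      by (smt (verit) mult_left_mono)
  qed (use K in simp)
  finally have main: "2 * (c * (b * P)) \<le>
      (2 * K * (1 + D) * \<kappa>) * (b * Q) + (2 * K * D * 2 powr \<alpha>) * (a * P)"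
    by (simp add: algebra_simps)
  have "(2 * K * (1 + D) * \<kappa>) * (b * Q) < (c * real m powr \<alpha>) * (b * Q)"
    using m(2) b0 Q1 by (intro mult_strict_right_mono) auto
  then have 1: "(2 * K * (1 + D) * \<kappa>) * (b * Q) < c * (b * P)"
    by (simp add: P mult_ac)
  have "(2 * K * D * 2 powr \<alpha>) * (a * P) \<le> (c * M) * (a * P)"
    using M(2) a0 by (intro mult_right_mono) (auto simp: P_def)
  also have "\<dots> = c * ((M * a) * P)" by simp
  also have "\<dots> \<le> c * (b * P)"
    using ab c by (intro mult_left_mono mult_right_mono) (auto simp: P_def)
  finally show False using main 1 by linarith
qed

end

section \<open>The gap between the democracy functions\<close>

lemma ln_powr_exceeds:
  assumes "\<gamma> > 0"
  shows "\<exists>q\<ge>2::nat. Z < ln (real q) powr \<gamma>"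
proof -
  have "filterlim (\<lambda>q. ln (real q) powr \<gamma>) at_top sequentially"
    using assms by (intro filterlim_compose[OF powr_real_at_top] filterlim_compose[OF ln_at_top]
        filterlim_real_sequentially) auto
  then have "\<forall>\<^sub>F q in sequentially. Z < ln (real q) powr \<gamma>"
    by (simp add: filterlim_at_top_dense)
  then have "\<forall>\<^sub>F q in sequentially. 2 \<le> q \<and> Z < ln (real q) powr \<gamma>"
    using eventually_ge_at_top[of 2] by eventually_elim auto
  then show ?thesis using eventually_happens sequentially_bot by blast
qed

text \<open>Passing from \<open>q\<close> to \<open>m q\<close> changes \<open>q\<^sup>\<beta>\<close> by the constant factor \<open>m\<^sup>\<beta>\<close> only, and the
  logarithmic factor outgrows every constant. In the second case the logarithm is that of
  \<open>m q\<close>, which is at least that of \<open>q\<close>.\<close>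

lemma democracy_gap:
  assumes "\<gamma> > 0"
    and alt: "(lesssim_from_2 (\<lambda>N. real N powr \<beta> * ln (real N) powr \<gamma>) u \<and>
               lesssim_from_2 l (\<lambda>N. real N powr \<beta>)) \<or>
              (lesssim_from_2 (\<lambda>N. real N powr \<beta>) u \<and>
               lesssim_from_2 l (\<lambda>N. real N powr \<beta> * ln (real N) powr (- \<gamma>)))"
    and m: "1 \<le> (m::nat)" and M: "(1::real) \<le> M"
  shows "\<exists>q\<ge>1. M * l (m * q) < u q"
  using alt
proof (elim disjE conjE)
  assume "lesssim_from_2 (\<lambda>N. real N powr \<beta> * ln (real N) powr \<gamma>) u"
    and "lesssim_from_2 l (\<lambda>N. real N powr \<beta>)"
  then obtain C1 C2 where C1: "C1 > 0" "\<And>N. N \<ge> 2 \<Longrightarrow> real N powr \<beta> * ln (real N) powr \<gamma> \<le> C1 * u N"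
    and C2: "C2 > 0" "\<And>N. N \<ge> 2 \<Longrightarrow> l N \<le> C2 * real N powr \<beta>"
    unfolding lesssim_from_2_def by blast
  obtain q :: nat where q: "q \<ge> 2" "M * C1 * C2 * real m powr \<beta> < ln (real q) powr \<gamma>"
    using ln_powr_exceeds[OF assms(1)] by blast
  have mq: "m * q \<ge> 2" using mult_le_mono[OF m q(1)] by simp
  have "C1 * (M * l (m * q)) \<le> C1 * (M * (C2 * real (m * q) powr \<beta>))"
    using C1(1) M C2(2)[OF mq] by (intro mult_left_mono) auto
  also have "\<dots> = real q powr \<beta> * (M * C1 * C2 * real m powr \<beta>)"
    by (simp add: powr_mult algebra_simps)
  also have "\<dots> < real q powr \<beta> * ln (real q) powr \<gamma>"
    using q by (intro mult_strict_left_mono) auto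
  also have "\<dots> \<le> C1 * u q" using C1(2) q(1) by simp
  finally have "M * l (m * q) < u q" using C1(1) by simp
  then show ?thesis using q(1) by (intro exI[of _ q]) auto
next
  assume "lesssim_from_2 (\<lambda>N. real N powr \<beta>) u"
    and "lesssim_from_2 l (\<lambda>N. real N powr \<beta> * ln (real N) powr (- \<gamma>))"
  then obtain C1 C2 where C1: "C1 > 0" "\<And>N. N \<ge> 2 \<Longrightarrow> real N powr \<beta> \<le> C1 * u N"
    and C2: "C2 > 0" "\<And>N. N \<ge> 2 \<Longrightarrow> l N \<le> C2 * (real N powr \<beta> * ln (real N) powr (- \<gamma>))"
    unfolding lesssim_from_2_def by blast
  obtain q :: nat where q: "q \<ge> 2" "M * C1 * C2 * real m powr \<beta> < ln (real q) powr \<gamma>"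
    using ln_powr_exceeds[OF assms(1)] by blast
  have mq: "m * q \<ge> 2" using mult_le_mono[OF m q(1)] by simp
  have lnq: "0 < ln (real q)" "ln (real q) \<le> ln (real (m * q))"
    using q(1) m by (auto simp del: of_nat_mult)
  have "ln (real q) powr \<gamma> \<le> ln (real (m * q)) powr \<gamma>"
    using lnq assms(1) by (intro powr_mono2) auto
  then have big: "M * C1 * C2 * real m powr \<beta> * ln (real (m * q)) powr (- \<gamma>) < 1"
    using q(2) lnq by (simp add: powr_minus field_simps)
  have "C1 * (M * l (m * q)) \<le> C1 * (M * (C2 * (real (m * q) powr \<beta> * ln (real (m * q)) powr (- \<gamma>))))"
    using C1(1) M C2(2)[OF mq] by (intro mult_left_mono) auto
  also have "\<dots> = real q powr \<beta> * (M * C1 * C2 * real m powr \<beta> * ln (real (m * q)) powr (- \<gamma>))"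
    by (simp add: powr_mult algebra_simps)
  also have "\<dots> < real q powr \<beta> * 1"
    using q big by (intro mult_strict_left_mono) auto
  also have "\<dots> \<le> C1 * u q" using C1(2) q(1) by simp
  finally have "M * l (m * q) < u q" using C1(1) by simp
  then show ?thesis using q(1) by (intro exI[of _ q]) auto
qed

theorem corollary7p3:
  fixes scale :: "'k::real_normed_field \<Rightarrow> 'b::ab_group_add \<Rightarrow> 'b"
    and qnorm :: "'b \<Rightarrow> real" and \<rho> :: real and e :: "nat \<Rightarrow> 'b" and \<beta> \<gamma> :: real
  assumes "quasi_banach_space scale qnorm \<rho>"
    and "unconditional_basis scale qnorm e 1"
    and "\<And>j. qnorm (e j) = 1"
    and "\<beta> \<ge> 0" and "\<gamma> > 0"
    and "(lesssim_from_2 (\<lambda>N. real N powr \<beta> * ln (real N) powr \<gamma>) (h_r qnorm e) \<and>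
          lesssim_from_2 (h_l qnorm e) (\<lambda>N. real N powr \<beta>)) \<or>
         (lesssim_from_2 (\<lambda>N. real N powr \<beta>) (h_r qnorm e) \<and>
          lesssim_from_2 (h_l qnorm e) (\<lambda>N. real N powr \<beta> * ln (real N) powr (- \<gamma>)))"
  shows "\<forall>\<alpha>::real. \<forall>\<tau>::ereal. 0 < \<alpha> \<longrightarrow> 0 < \<tau> \<longrightarrow>
           \<not> same_space (greedy_class scale qnorm e \<alpha> \<tau>) (approx_space scale qnorm e \<alpha> \<tau>)"
proof (intro allI impI notI)
  fix \<alpha> :: real and \<tau> :: ereal
  assume \<alpha>: "0 < \<alpha>" and \<tau>: "0 < \<tau>"
    and same: "same_space (greedy_class scale qnorm e \<alpha> \<tau>) (approx_space scale qnorm e \<alpha> \<tau>)"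
  interpret quasi_banach_unconditional_basis scale qnorm \<rho> e
    using assms(1,2)
    by (simp add: quasi_banach_unconditional_basis_def quasi_banach_unconditional_basis_axioms_def)
  have "\<not> embeds (approx_space scale qnorm e \<alpha> \<tau>) (greedy_class scale qnorm e \<alpha> \<tau>)"
    using democracy_gap[OF assms(5,6)] \<alpha> \<tau> by (intro not_approx_embeds_greedy)
  then show False using same by (simp add: same_space_def)
qed

end
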